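(* Let $A$ and $B$ be nonempty finite subsets of an abelian group $G$, with $|A| = |B|$ and $1 \notin B$. Let $d$ and $n$ be integers such that $0 \leq d \leq |B|$ and $n > 0$. Assume that $A$ contains no progression with ratio in $B$ and of length greater than $n$. Also, assume that all but at most $d$ elements of $B$ have order greater than $n$. Then there exists a partial matching of $(A,B)$ with defect $d$.
   Context: The group $G$ is written multiplicatively with identity $1$. The order of $x \in G$ is denoted $o(x)$ (possibly infinite). A progression of length $n$ in $G$ is a sequence of the form $a, ax, \ldots, ax^{n-1}$ where $a,x \in G$ and $0 \leq n-1 < o(x)$; if $n>1$, $x$ is called the ratio of the progression. For nonempty finite $A,B \subseteq G$ with $|A|=|B|$, a partial matching of $(A,B)$ with defect $d$ is an injective map $f : A' \to B$, where $A' \subseteq A$ and $|A \setminus A'| = d$, such that $a f(a) \notin A$ for all $a \in A'$. The empty map (with $A' = \emptyset$) is allowed. *)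

theory Defs
  imports "HOL-Algebra.Multiplicative_Group" "HOL-Library.Extended_Nat"
begin

text \<open>The library's \<^const>\<open>group.ord\<close> encodes infinite order by \<open>0\<close>; here infinite order
  is \<open>\<infinity>\<close>, so that strict lower bounds on the order hold for elements of infinite order.\<close>

definition elem_order :: "('a, 'b) monoid_scheme \<Rightarrow> 'a \<Rightarrow> enat" where
  "elem_order G x = (if group.ord G x = 0 then \<infinity> else enat (group.ord G x))"

definition progression_from_by :: "('a, 'b) monoid_scheme \<Rightarrow> 'a \<Rightarrow> 'a \<Rightarrow> 'a list \<Rightarrow> bool" where
  "progression_from_by G a x xs \<longleftrightarrow>
     a \<in> carrier G \<and> x \<in> carrier G \<and> 0 < length xs \<and> enat (length xs - 1) < elem_order G x \<and>
     xs = map (\<lambda>i. a \<otimes>\<^bsub>G\<^esub> x [^]\<^bsub>G\<^esub> i) [0..<length xs]"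

text \<open>A one-term progression has no ratio.\<close>

definition progression_with_ratio :: "('a, 'b) monoid_scheme \<Rightarrow> 'a \<Rightarrow> 'a list \<Rightarrow> bool" where
  "progression_with_ratio G x xs \<longleftrightarrow> 1 < length xs \<and> (\<exists>a. progression_from_by G a x xs)"

text \<open>The matching is a partial map from \<open>A\<close> to \<open>B\<close>, given by its domain \<open>A'\<close> together with a
  total HOL function \<open>f\<close> whose values outside \<open>A'\<close> are irrelevant. The definition is meant for
  nonempty finite \<open>A\<close> and \<open>B\<close> with \<open>card A = card B\<close>.\<close>

definition partial_matching ::
  "('a, 'b) monoid_scheme \<Rightarrow> 'a set \<Rightarrow> 'a set \<Rightarrow> nat \<Rightarrow> 'a set \<Rightarrow> ('a \<Rightarrow> 'a) \<Rightarrow> bool" where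
  "partial_matching G A B d A' f \<longleftrightarrow>
     A' \<subseteq> A \<and> card (A - A') = d \<and> f \<in> A' \<rightarrow> B \<and> inj_on f A' \<and>
     (\<forall>a\<in>A'. a \<otimes>\<^bsub>G\<^esub> f a \<notin> A)"

end

theory Submission
  imports Defs
begin

text \<open>By the defect form of Hall's theorem it suffices to bound, for nonempty \<open>S \<subseteq> A\<close>, the set
  \<open>V\<close> of all \<open>b \<in> B\<close> with \<open>S b \<subseteq> A\<close>. Discarding the at most \<open>d\<close> elements of small order from
  \<open>V\<close>, no coset \<open>a\<langle>b\<rangle>\<close> with \<open>b \<in> V\<close> lies in \<open>A\<close>, since it would contain a progression that is
  too long. Under this condition \<open>S (V \<union> {1}) \<subseteq> A\<close> forces \<open>|S| + |V| \<le> |A|\<close>. This is shown by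
  the Dyson transform \<open>(S, V) \<mapsto> (S \<union> eV, V \<inter> e\<inverse>S)\<close> with \<open>e \<in> S\<close>, which can only get stuck
  when \<open>SV = S\<close>, that is, when \<open>S\<close> is a union of cosets of the group generated by \<open>V\<close>.\<close>

text \<open>Induction on \<open>A\<close>, with \<open>N\<close> generalised because neighbourhoods
  shrink. If some proper nonempty \<open>S\<close> is tight, \<open>S\<close> and
  \<open>A - S\<close> are matched separately; otherwise every such set has a spare neighbour, so
  one pair can be fixed freely.\<close>

lemma hall_marriage:
  assumes "finite A" and "\<And>a. a \<in> A \<Longrightarrow> finite (N a)"
    and "\<And>S. S \<subseteq> A \<Longrightarrow> card S \<le> card (\<Union>a\<in>S. N a)"
  shows "\<exists>f. inj_on f A \<and> (\<forall>a\<in>A. f a \<in> N a)"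
  using assms
proof (induction A arbitrary: N rule: finite_psubset_induct)
  case (psubset A)
  have finU: "finite (\<Union>a\<in>T. N a)" if "T \<subseteq> A" for T
    using that psubset.hyps psubset.prems(1) by (meson finite_UN_I finite_subset subsetD)
  show ?case
  proof (cases "\<exists>S. S \<subset> A \<and> S \<noteq> {} \<and> card (\<Union>a\<in>S. N a) = card S")
    case True
    then obtain S where S: "S \<subset> A" "S \<noteq> {}" and tight: "card (\<Union>a\<in>S. N a) = card S"
      by blast
    define U where "U = (\<Union>a\<in>S. N a)"
    have "\<exists>f. inj_on f S \<and> (\<forall>a\<in>S. f a \<in> N a)"
      by (rule psubset.IH) (use S psubset.prems in auto)
    then obtain f where f: "inj_on f S" "\<forall>a\<in>S. f a \<in> N a" by blast
    have "\<exists>g. inj_on g (A - S) \<and> (\<forall>a\<in>A - S. g a \<in> N a - U)"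
    proof (rule psubset.IH)
      fix T assume T: "T \<subseteq> A - S"
      have fin: "finite S" "finite T"
        using S T psubset.hyps finite_subset by (blast, blast)
      have sub: "(\<Union>a\<in>T. N a - U) \<subseteq> (\<Union>a\<in>S \<union> T. N a)" by blast
      have "S \<union> T \<subseteq> A" using S T by blast
      \<comment> \<open>Hall's condition survives the deletion of \<open>U\<close>: apply it to
        \<open>S \<union> T\<close> and cancel \<open>card U = card S\<close>.\<close>
      have "card S + card T = card (S \<union> T)"
        using T fin by (intro card_Un_disjoint[symmetric]) auto
      also have "\<dots> \<le> card (\<Union>a\<in>S \<union> T. N a)"
        using psubset.prems(2)[OF \<open>S \<union> T \<subseteq> A\<close>] .
      also have "(\<Union>a\<in>S \<union> T. N a) = U \<union> (\<Union>a\<in>T. N a - U)"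
        by (auto simp: U_def)
      also have "card \<dots> \<le> card U + card (\<Union>a\<in>T. N a - U)"
        by (rule card_Un_le)
      finally show "card T \<le> card (\<Union>a\<in>T. N a - U)"
        using tight by (simp add: U_def)
    qed (use S psubset.prems in auto)
    then obtain g where g: "inj_on g (A - S)" "\<forall>a\<in>A - S. g a \<in> N a - U" by blast
    define h where "h a = (if a \<in> S then f a else g a)" for a
    have cross: "f a \<noteq> g b" if "a \<in> S" "b \<in> A - S" for a b
      using that f(2) g(2) by (fastforce simp: U_def)
    have "inj_on h A"
    proof (rule inj_onI)
      fix a b assume ab: "a \<in> A" "b \<in> A" "h a = h b"
      show "a = b"
        using ab f(1) g(1) cross[of a b] cross[of b a]
        by (cases "a \<in> S"; cases "b \<in> S") (auto simp: h_def inj_on_def)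
    qed
    moreover have "\<forall>a\<in>A. h a \<in> N a"
      using f(2) g(2) by (auto simp: h_def)
    ultimately show ?thesis by blast
  next
    case False
    show ?thesis
    proof (cases "A = {}")
      case True
      then show ?thesis by simp
    next
      case False
      then obtain x where x: "x \<in> A" by blast
      have "N x \<noteq> {}"
        using psubset.prems(2)[of "{x}"] x by auto
      then obtain y where y: "y \<in> N x" by blast
      have "\<exists>g. inj_on g (A - {x}) \<and> (\<forall>a\<in>A - {x}. g a \<in> N a - {y})"
      proof (rule psubset.IH)
        fix T assume T: "T \<subseteq> A - {x}"
        show "card T \<le> card (\<Union>a\<in>T. N a - {y})"
        proof (cases "T = {}")
          case False
          have "T \<subset> A" using T x by blast
          \<comment> \<open>No proper nonempty subset is tight here, and the strict inequality pays
            for the loss of \<open>y\<close>.\<close>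
          then have "card T < card (\<Union>a\<in>T. N a)"
            using \<open>\<not> (\<exists>S. S \<subset> A \<and> S \<noteq> {} \<and> card (\<Union>a\<in>S. N a) = card S)\<close>
              psubset.prems(2)[of T] False by (metis le_neq_implies_less psubset_imp_subset)
          moreover have "(\<Union>a\<in>T. N a - {y}) = (\<Union>a\<in>T. N a) - {y}" by blast
          ultimately show ?thesis
            using finU[of T] \<open>T \<subset> A\<close> by (auto simp: card_Diff_singleton_if)
        qed simp
      qed (use x psubset.prems in auto)
      then obtain g where g: "inj_on g (A - {x})" "\<forall>a\<in>A - {x}. g a \<in> N a - {y}" by blast
      have "inj_on (g(x := y)) A \<and> (\<forall>a\<in>A. (g(x := y)) a \<in> N a)"
        using g y by (auto simp: inj_on_def)
      then show ?thesis by blast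
    qed
  qed
qed

lemma hall_marriage_defect:
  fixes N :: "'a \<Rightarrow> 'b set"
  assumes "finite A" and "\<And>a. a \<in> A \<Longrightarrow> finite (N a)" and "d \<le> card A"
    and hall: "\<And>S. S \<subseteq> A \<Longrightarrow> S \<noteq> {} \<Longrightarrow> card S \<le> card (\<Union>a\<in>S. N a) + d"
  shows "\<exists>A' f. A' \<subseteq> A \<and> card (A - A') = d \<and> inj_on f A' \<and> (\<forall>a\<in>A'. f a \<in> N a)"
proof -
  \<comment> \<open>\<open>d\<close> dummy elements adjacent to everything absorb the defect.\<close>
  define M :: "'a \<Rightarrow> ('b + nat) set" where "M a = Inl ` N a \<union> Inr ` {..<d}" for a
  have "\<exists>g. inj_on g A \<and> (\<forall>a\<in>A. g a \<in> M a)"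
  proof (rule hall_marriage)
    fix S assume S: "S \<subseteq> A"
    show "card S \<le> card (\<Union>a\<in>S. M a)"
    proof (cases "S = {}")
      case False
      have fin: "finite (\<Union>a\<in>S. N a)"
        using S assms(1,2) by (meson finite_UN_I finite_subset subsetD)
      have "(\<Union>a\<in>S. M a) = (\<Union>a\<in>S. N a) <+> {..<d}"
        using False by (auto simp: M_def)
      then have "card (\<Union>a\<in>S. M a) = card (\<Union>a\<in>S. N a) + d"
        using fin by (simp add: card_Plus)
      then show ?thesis using hall[OF S False] by simp
    qed simp
  qed (use assms in \<open>auto simp: M_def\<close>)
  then obtain g where g: "inj_on g A" "\<forall>a\<in>A. g a \<in> M a" by blast
  define D where "D = {a \<in> A. g a \<in> Inr ` {..<d}}"
  have "card D \<le> card (Inr ` {..<d} :: ('b + nat) set)"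
    using g(1) by (intro card_inj_on_le[of g]) (auto simp: D_def intro: inj_on_subset)
  then have "card D \<le> d" by (simp add: card_image)
  \<comment> \<open>Possibly fewer than \<open>d\<close> elements received a dummy. Since the defect
    must be exactly \<open>d\<close>, further elements are dropped, which needs
    \<open>d \<le> card A\<close>.\<close>
  then obtain E where E: "D \<subseteq> E" "E \<subseteq> A" "card E = d"
    using exists_subset_between[of D d A] assms(1,3) by (auto simp: D_def)
  have gN: "\<exists>b \<in> N a. g a = Inl b" if "a \<in> A - E" for a
  proof -
    have "g a \<in> M a" "g a \<notin> Inr ` {..<d}" using that g(2) E(1) by (auto simp: D_def)
    then show ?thesis by (auto simp: M_def)
  qed
  have "A - (A - E) = E" using E(2) by blast
  moreover have "inj_on (projl \<circ> g) (A - E)"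
  proof (rule inj_onI)
    fix a b assume "a \<in> A - E" "b \<in> A - E" "(projl \<circ> g) a = (projl \<circ> g) b"
    then show "a = b" using gN[of a] gN[of b] inj_onD[OF g(1), of a b] by auto
  qed
  moreover have "\<forall>a\<in>A - E. (projl \<circ> g) a \<in> N a"
  proof
    fix a assume "a \<in> A - E"
    then show "(projl \<circ> g) a \<in> N a" using gN[of a] by auto
  qed
  ultimately show ?thesis using E(3)
    by (intro exI[of _ "A - E"] exI[of _ "projl \<circ> g"]) auto
qed

text \<open>The transform preserves \<open>card S + card V\<close> and strictly shrinks
  \<open>V\<close>, hence the induction on \<open>V\<close> for arbitrary \<open>S\<close>. Here
  \<open>V\<close> contains \<open>\<one>\<close>, which gives \<open>S \<subseteq> A\<close> and
  accounts for the \<open>+ 1\<close>.\<close>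

lemma (in comm_group) dyson_transform_bound:
  assumes "finite A" and "finite V" and "V \<subseteq> carrier G" and "\<one> \<in> V"
    and "S \<subseteq> carrier G" and "S \<noteq> {}"
    and "\<And>s v. s \<in> S \<Longrightarrow> v \<in> V \<Longrightarrow> s \<otimes> v \<in> A"
    and "\<And>a v. a \<in> carrier G \<Longrightarrow> v \<in> V \<Longrightarrow> v \<noteq> \<one> \<Longrightarrow> \<exists>i::nat. a \<otimes> v [^] i \<notin> A"
  shows "card S + card V \<le> card A + 1"
  using assms(2-)
proof (induction V arbitrary: S rule: finite_psubset_induct)
  case (psubset V)
  have SA: "S \<subseteq> A"
    using psubset.prems(2,3,5) by (metis r_one subsetD subsetI)
  have finS: "finite S" using SA assms(1) finite_subset by blast
  show ?case
  \<comment> \<open>In the stuck case \<open>S\<close> contains every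
    \<open>a \<otimes> v [^] i\<close>, so the last hypothesis leaves only \<open>\<one>\<close> in
    \<open>V\<close>.\<close>
  proof (cases "\<forall>s\<in>S. \<forall>v\<in>V. s \<otimes> v \<in> S")
    case True
    obtain a where a: "a \<in> S" using psubset.prems(4) by blast
    have "V \<subseteq> {\<one>}"
    proof (rule subsetI, rule ccontr)
      fix v assume v: "v \<in> V" "v \<notin> {\<one>}"
      have carr: "a \<in> carrier G" "v \<in> carrier G" using a v psubset.prems by auto
      have "a \<otimes> v [^] i \<in> S" for i :: nat
      proof (induction i)
        case 0
        then show ?case using a carr by simp
      next
        case (Suc i)
        then have "(a \<otimes> v [^] i) \<otimes> v \<in> S" using True v by blast
        then show ?case using carr by (simp add: m_assoc)
      qed
      then show False using psubset.prems(6)[OF carr(1) v(1)] v(2) SA by blast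
    qed
    then have "card V \<le> 1" using card_mono[of "{\<one>}" V] by simp
    moreover have "card S \<le> card A" using SA assms(1) card_mono by blast
    ultimately show ?thesis by linarith
  next
    case False
    then obtain e w where e: "e \<in> S" and w: "w \<in> V" "e \<otimes> w \<notin> S" by blast
    \<comment> \<open>The products of \<open>e\<close> with \<open>V'\<close> already lie in
      \<open>S\<close>, so \<open>S'\<close> only adds those with \<open>V - V'\<close>. This union
      is disjoint and the count exact; \<open>w\<close> makes \<open>V'\<close> a proper
      subset.\<close>
    define V' where "V' = {v \<in> V. e \<otimes> v \<in> S}"
    define S' where "S' = S \<union> (\<lambda>v. e \<otimes> v) ` (V - V')"
    have ec: "e \<in> carrier G" using e psubset.prems by blast
    have "inj_on (\<lambda>v. e \<otimes> v) (V - V')"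
      using ec psubset.prems(1) by (auto simp: inj_on_def subset_iff)
    moreover have "S \<inter> (\<lambda>v. e \<otimes> v) ` (V - V') = {}" by (auto simp: V'_def)
    ultimately have "card S' = card S + card (V - V')"
      using psubset.hyps finS by (simp add: S'_def card_Un_disjoint card_image)
    moreover have "card V = card V' + card (V - V')"
      using psubset.hyps card_Diff_subset[of V' V] card_mono[of V V']
      by (auto simp: V'_def)
    moreover have "card S' + card V' \<le> card A + 1"
    proof (rule psubset.IH)
      show "V' \<subset> V" using w by (auto simp: V'_def)
      show "V' \<subseteq> carrier G" using psubset.prems(1) by (auto simp: V'_def)
      show "\<one> \<in> V'" using psubset.prems(2) e ec by (simp add: V'_def)
      show "S' \<subseteq> carrier G" using psubset.prems(1,3) ec by (auto simp: S'_def)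
      show "S' \<noteq> {}" using e by (auto simp: S'_def)
      show "s \<otimes> v \<in> A" if sv: "s \<in> S'" "v \<in> V'" for s v
      proof (cases "s \<in> S")
        case True
        then show ?thesis using sv psubset.prems(5) by (simp add: V'_def)
      next
        case False
        then obtain u where u: "u \<in> V" "s = e \<otimes> u" using sv by (auto simp: S'_def)
        have "v \<in> carrier G" "u \<in> carrier G"
          using sv u psubset.prems(1) by (auto simp: V'_def)
        \<comment> \<open>Commutativity moves \<open>v\<close> next to \<open>e\<close>, and
          \<open>e \<otimes> v \<in> S\<close> by the choice of \<open>V'\<close>.\<close>
        then have "s \<otimes> v = (e \<otimes> v) \<otimes> u" using u ec by (simp add: m_ac)
        then show ?thesis using sv u psubset.prems(5) by (simp add: V'_def)
      qed
      show "\<exists>i::nat. a \<otimes> v [^] i \<notin> A" if "a \<in> carrier G" "v \<in> V'" "v \<noteq> \<one>" for a v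
        using that psubset.prems(6) by (simp add: V'_def)
    qed
    ultimately show ?thesis by linarith
  qed
qed

text \<open>Otherwise the first \<open>n + 1\<close> terms form a forbidden progression: order
  greater than \<open>n\<close> is exactly what that length requires, and \<open>n > 0\<close> makes
  the length exceed 1, so that \<open>x\<close> counts as a ratio.\<close>

lemma exists_power_notin:
  fixes G (structure)
  assumes "a \<in> carrier G" and "x \<in> carrier G" and "n > 0" and "elem_order G x > enat n"
    and "\<not> (\<exists>xs. progression_with_ratio G x xs \<and> length xs > n \<and> set xs \<subseteq> A)"
  shows "\<exists>i::nat. a \<otimes> x [^] i \<notin> A"
proof (rule ccontr)
  assume "\<not> (\<exists>i::nat. a \<otimes> x [^] i \<notin> A)"
  then have all: "a \<otimes> x [^] i \<in> A" for i :: nat by blast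
  define xs where "xs = map (\<lambda>i::nat. a \<otimes> x [^] i) [0..<Suc n]"
  have len: "length xs = Suc n" by (simp add: xs_def)
  have "progression_from_by G a x xs"
    unfolding progression_from_by_def len using assms(1,2,4) by (simp add: xs_def)
  then have "progression_with_ratio G x xs"
    using assms(3) len by (auto simp: progression_with_ratio_def)
  moreover have "set xs \<subseteq> A" using all by (auto simp: xs_def)
  ultimately show False using assms(5) len by auto
qed

theorem corollary3p7:
  fixes G (structure) and A B :: "'a set" and d n :: nat
  assumes "comm_group G"
    and "A \<subseteq> carrier G" and "finite A" and "A \<noteq> {}"
    and "B \<subseteq> carrier G" and "finite B" and "B \<noteq> {}"
    and "card A = card B"
    and "\<one> \<notin> B"
    and "d \<le> card B"
    and "n > 0"
    and "\<not> (\<exists>xs. \<exists>x\<in>B. progression_with_ratio G x xs \<and> length xs > n \<and> set xs \<subseteq> A)"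
    and "card {b \<in> B. \<not> elem_order G b > enat n} \<le> d"
  shows "\<exists>A' f. partial_matching G A B d A' f"
proof -
  interpret comm_group G by fact
  define N where "N a = {b \<in> B. a \<otimes> b \<notin> A}" for a
  define D where "D = {b \<in> B. \<not> elem_order G b > enat n}"
  have finD: "finite D" using assms(6) by (simp add: D_def)
  have "\<exists>A' f. A' \<subseteq> A \<and> card (A - A') = d \<and> inj_on f A' \<and> (\<forall>a\<in>A'. f a \<in> N a)"
  proof (rule hall_marriage_defect)
    fix S assume S: "S \<subseteq> A" "S \<noteq> {}"
    define U where "U = (\<Union>a\<in>S. N a)"
    \<comment> \<open>\<open>B - U\<close> consists of the \<open>b\<close> with all of
      \<open>S\<close> times \<open>b\<close> inside \<open>A\<close>. Removing \<open>D\<close>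
      leaves orders greater than \<open>n\<close>, as \<open>exists_power_notin\<close>
      requires.\<close>
    define V where "V = B - U - D"
    have finV: "finite V" using assms(6) by (simp add: V_def)
    have UB: "U \<subseteq> B" by (auto simp: U_def N_def)
    have "card S + card (insert \<one> V) \<le> card A + 1"
    proof (rule dyson_transform_bound)
      show "insert \<one> V \<subseteq> carrier G" using assms(5) by (auto simp: V_def)
      show "S \<subseteq> carrier G" using S assms(2) by blast
      show "s \<otimes> v \<in> A" if "s \<in> S" "v \<in> insert \<one> V" for s v
        using that S assms(2) by (auto simp: V_def U_def N_def subset_iff)
      show "\<exists>i::nat. a \<otimes> v [^] i \<notin> A"
        if "a \<in> carrier G" "v \<in> insert \<one> V" "v \<noteq> \<one>" for a v
        by (rule exists_power_notin[where n = n]) (use that assms in \<open>auto simp: V_def D_def\<close>)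
    qed (use finV assms(3) S in auto)
    \<comment> \<open>As \<open>\<one> \<notin> B\<close>, the adjoined identity is new and cancels
      the \<open>+ 1\<close> of the bound.\<close>
    moreover have "card (insert \<one> V) = card V + 1"
      using finV assms(9) by (simp add: V_def)
    moreover have "card B \<le> card U + card V + card D"
    proof -
      have "B \<subseteq> U \<union> V \<union> D" by (auto simp: V_def)
      then have "card B \<le> card (U \<union> V \<union> D)"
        using finV finD UB assms(6) by (meson card_mono finite_UnI finite_subset)
      also have "\<dots> \<le> card U + card V + card D"
        by (meson card_Un_le add_le_mono1 order_trans)
      finally show ?thesis .
    qed
    \<comment> \<open>\<open>card S \<le> card A - card V = card B - card V \<le> card U + card
      D\<close>, and \<open>card D \<le> d\<close>.\<close>
    ultimately show "card S \<le> card (\<Union>a\<in>S. N a) + d"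
      using assms(8,13) unfolding U_def[symmetric] D_def[symmetric] by linarith
  qed (use assms in \<open>auto simp: N_def\<close>)
  then show ?thesis
    unfolding partial_matching_def N_def by blast
qed

end
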